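(* Let $G$ be a group acting properly discontinuously and co-boundedly on a metric space $X$. Then $$G_X = \bigcup \{Z(H) \mid H\le G,\ |G/H|<\infty\},$$ where $G_X$ is the coarse kernel of the action and $Z(H)$ denotes the center of $H$.
   Context: All actions are by isometries. For a group $G$ acting on a metric space $(X,d)$, the coarse kernel is $$G_X := \{g\in G \mid \exists C>0 \text{ such that } d(g\cdot x,x)\le C \text{ for all } x\in X\}.$$ The union ranges over all finite index subgroups $H$ of $G$ ($|G/H|$ denotes the index). The action is properly discontinuous if for every $x\in X$ and every $r>0$ there are only finitely many $g\in G$ with $d(g\cdot x,x)\le r$. The action is co-bounded if some (equivalently every) orbit is quasi-dense, i.e. there are $x_0\in X$ and $L>0$ such that every point of $X$ is within distance $L$ of $G\cdot x_0$. *)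

theory Defs
  imports "HOL-Analysis.Analysis" "HOL-Algebra.Group_Action" "HOL-Algebra.Left_Coset"
begin

locale isometric_action = Metric_space M d + group_action G M \<phi>
  for G :: "('g, 'r) monoid_scheme" (structure)
    and M :: "'a set" and d :: "'a \<Rightarrow> 'a \<Rightarrow> real" and \<phi> :: "'g \<Rightarrow> 'a \<Rightarrow> 'a" +
  assumes isometric:
    "\<lbrakk>g \<in> carrier G; x \<in> M; y \<in> M\<rbrakk> \<Longrightarrow> d (\<phi> g x) (\<phi> g y) = d x y"

definition coarse_kernel ::
  "('g, 'r) monoid_scheme \<Rightarrow> 'a set \<Rightarrow> ('a \<Rightarrow> 'a \<Rightarrow> real) \<Rightarrow> ('g \<Rightarrow> 'a \<Rightarrow> 'a) \<Rightarrow> 'g set"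
  where "coarse_kernel G M d \<phi> =
    {g \<in> carrier G. \<exists>C>0. \<forall>x\<in>M. d (\<phi> g x) x \<le> C}"

(* Metric proper discontinuity: finiteness for displacement at most r, for every r,
   rather than for a neighbourhood of each point. *)
definition properly_discontinuous_action ::
  "('g, 'r) monoid_scheme \<Rightarrow> 'a set \<Rightarrow> ('a \<Rightarrow> 'a \<Rightarrow> real) \<Rightarrow> ('g \<Rightarrow> 'a \<Rightarrow> 'a) \<Rightarrow> bool"
  where "properly_discontinuous_action G M d \<phi> \<longleftrightarrow>
    (\<forall>x\<in>M. \<forall>r>0. finite {g \<in> carrier G. d (\<phi> g x) x \<le> r})"

(* Some orbit is quasi-dense; in particular M is nonempty. *)
definition cobounded_action ::
  "('g, 'r) monoid_scheme \<Rightarrow> 'a set \<Rightarrow> ('a \<Rightarrow> 'a \<Rightarrow> real) \<Rightarrow> ('g \<Rightarrow> 'a \<Rightarrow> 'a) \<Rightarrow> bool"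
  where "cobounded_action G M d \<phi> \<longleftrightarrow>
    (\<exists>x0\<in>M. \<exists>L>0. \<forall>x\<in>M. \<exists>y\<in>orbit G \<phi> x0. d x y \<le> L)"

definition group_center :: "('g, 'r) monoid_scheme \<Rightarrow> 'g set"
  where "group_center G =
    {z \<in> carrier G. \<forall>g\<in>carrier G. z \<otimes>\<^bsub>G\<^esub> g = g \<otimes>\<^bsub>G\<^esub> z}"

end

theory Submission
  imports Defs
begin

text \<open>
  Both sides of the equation consist of the elements whose conjugacy class is finite.

  On the algebraic side, \<open>g\<close> is central in some finite index subgroup if and only if its
  centralizer has finite index: a subgroup in which \<open>g\<close> is central lies in the centralizer, and
  \<open>g\<close> is central in its own centralizer. The left cosets of the centralizer are the fibres of
  \<open>h \<mapsto> h g h\<inverse>\<close>, so they correspond to the conjugates of \<open>g\<close>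
  (\<open>conjugacy_class_finite\<close>, \<open>centralizer_index_finite\<close>).

  On the geometric side, the isometry \<open>h\<close> carries the displacement of \<open>g\<close> at \<open>h\<inverse> x\<close> to the
  displacement of the conjugate \<open>h g h\<inverse>\<close> at \<open>x\<close>. If \<open>g\<close> has bounded displacement, then all its
  conjugates displace a single point by a bounded amount, and proper discontinuity leaves only
  finitely many of them. Conversely, a finite conjugacy class bounds the displacement of \<open>g\<close>
  along one orbit; when this orbit is quasi-dense, at distance at most \<open>L\<close> from every point,
  the displacement is bounded everywhere, with a loss of at most \<open>2 L\<close>.
\<close>

section \<open>Conjugacy classes and centralizers\<close>

context group
begin

definition centralizer :: "'a \<Rightarrow> 'a set"
  where "centralizer z = {h \<in> carrier G. z \<otimes> h = h \<otimes> z}"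

definition conjugacy_class :: "'a \<Rightarrow> 'a set"
  where "conjugacy_class z = (\<lambda>h. h \<otimes> z \<otimes> inv h) ` carrier G"

lemma subgroup_centralizer:
  assumes z: "z \<in> carrier G"
  shows "subgroup (centralizer z) G"
proof (rule subgroupI)
  show "centralizer z \<subseteq> carrier G"
    by (auto simp: centralizer_def)
  show "centralizer z \<noteq> {}"
    using z by (auto simp: centralizer_def)
next
  fix a assume a: "a \<in> centralizer z"
  then have aG: "a \<in> carrier G" and comm: "z \<otimes> a = a \<otimes> z"
    by (auto simp: centralizer_def)
  have "inv a \<otimes> (z \<otimes> a) \<otimes> inv a = inv a \<otimes> (a \<otimes> z) \<otimes> inv a"
    by (simp only: comm)
  moreover have "inv a \<otimes> (z \<otimes> a) \<otimes> inv a = inv a \<otimes> z"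
    using aG z by (simp add: m_assoc)
  moreover have "inv a \<otimes> (a \<otimes> z) \<otimes> inv a = z \<otimes> inv a"
    using aG z by (simp flip: m_assoc)
  ultimately have "z \<otimes> inv a = inv a \<otimes> z"
    by metis
  then show "inv a \<in> centralizer z"
    using aG by (simp add: centralizer_def)
next
  fix a b assume "a \<in> centralizer z" "b \<in> centralizer z"
  then have G: "a \<in> carrier G" "b \<in> carrier G"
    and comm: "z \<otimes> a = a \<otimes> z" "z \<otimes> b = b \<otimes> z"
    by (auto simp: centralizer_def)
  have "z \<otimes> (a \<otimes> b) = a \<otimes> (z \<otimes> b)"
    using G z comm(1) by (simp flip: m_assoc)
  also have "\<dots> = a \<otimes> b \<otimes> z"
    using G z comm(2) by (simp add: m_assoc)
  finally show "a \<otimes> b \<in> centralizer z"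
    using G by (simp add: centralizer_def)
qed

text \<open>
  The elements of a coset \<open>h H\<close> all conjugate \<open>z\<close> to the same element, because \<open>H\<close> commutes
  with \<open>z\<close>. Hence there are at most as many conjugates as cosets.
\<close>

lemma conjugacy_class_finite:
  assumes H: "subgroup H G" and fin: "finite (lcosets H)"
    and z: "z \<in> carrier G" and comm: "H \<subseteq> centralizer z"
  shows "finite (conjugacy_class z)"
proof -
  let ?c = "\<lambda>h. h \<otimes> z \<otimes> inv h"
  have conj_const: "?c (h \<otimes> k) = ?c h" if h: "h \<in> carrier G" and k: "k \<in> H" for h k
  proof -
    have kG: "k \<in> carrier G" and "k \<otimes> z = z \<otimes> k"
      using k comm by (auto simp: centralizer_def)
    then have "?c (h \<otimes> k) = h \<otimes> (z \<otimes> k) \<otimes> (inv k \<otimes> inv h)"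
      using h z by (simp add: inv_mult_group m_assoc)
    also have "\<dots> = ?c h"
    proof -
      have "k \<otimes> (inv k \<otimes> inv h) = inv h"
        using h kG by (simp flip: m_assoc)
      then show ?thesis
        using h z kG by (simp add: m_assoc)
    qed
    finally show ?thesis .
  qed
  have "finite (?c ` A)" if "A \<in> lcosets H" for A
  proof -
    obtain h where "h \<in> carrier G" "A = h <# H"
      using \<open>A \<in> lcosets H\<close> by (auto simp: LCOSETS_def)
    then have "?c ` A \<subseteq> {?c h}"
      using conj_const by (auto simp: l_coset_def)
    then show ?thesis
      by (rule finite_subset) simp
  qed
  moreover have "conjugacy_class z = (\<Union>A\<in>lcosets H. ?c ` A)"
    unfolding conjugacy_class_def using lcosets_part_G[OF H] by (metis image_Union)
  ultimately show ?thesis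
    using fin by simp
qed

text \<open>
  Two elements conjugate \<open>z\<close> to the same element only if they lie in the same coset of the
  centralizer, so every coset is the fibre over some conjugate.
\<close>

lemma centralizer_index_finite:
  assumes z: "z \<in> carrier G" and fin: "finite (conjugacy_class z)"
  shows "finite (lcosets (centralizer z))"
proof -
  let ?fibre = "\<lambda>w. {k \<in> carrier G. k \<otimes> z \<otimes> inv k = w}"
  have "h <# centralizer z = ?fibre (h \<otimes> z \<otimes> inv h)" if h: "h \<in> carrier G" for h
  proof -
    have "k \<in> h <# centralizer z \<longleftrightarrow> k \<in> ?fibre (h \<otimes> z \<otimes> inv h)" if k: "k \<in> carrier G" for k
    proof -
      have "k \<in> h <# centralizer z \<longleftrightarrow> inv h \<otimes> k \<in> centralizer z"
      proof
        assume "inv h \<otimes> k \<in> centralizer z"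
        moreover have "k = h \<otimes> (inv h \<otimes> k)"
          using h k by (simp add: m_assoc[symmetric])
        ultimately show "k \<in> h <# centralizer z"
          unfolding l_coset_def by blast
      qed (use h in \<open>auto simp: l_coset_def centralizer_def m_assoc[symmetric]\<close>)
      also have "\<dots> \<longleftrightarrow> z \<otimes> (inv h \<otimes> k) = inv h \<otimes> (k \<otimes> z)"
        using h k z by (simp add: centralizer_def m_assoc)
      also have "\<dots> \<longleftrightarrow> k \<otimes> z = h \<otimes> z \<otimes> inv h \<otimes> k"
        using h k z by (simp add: inv_solve_left m_assoc)
      also have "\<dots> \<longleftrightarrow> k \<otimes> z \<otimes> inv k = h \<otimes> z \<otimes> inv h"
        using h k z by (simp add: inv_solve_right')
      finally show ?thesis
        using k by simp
    qed
    moreover have "h <# centralizer z \<subseteq> carrier G"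
      using h by (auto simp: l_coset_def centralizer_def)
    ultimately show ?thesis by blast
  qed
  then have "lcosets (centralizer z) \<subseteq> ?fibre ` conjugacy_class z"
    by (auto simp: LCOSETS_def conjugacy_class_def)
  then show ?thesis
    using fin finite_surj by blast
qed

lemma central_in_finite_index_iff:
  "(\<exists>H. subgroup H G \<and> finite (lcosets H) \<and> z \<in> group_center (G\<lparr>carrier := H\<rparr>)) \<longleftrightarrow>
    z \<in> carrier G \<and> finite (conjugacy_class z)" (is "?L \<longleftrightarrow> ?R")
proof
  assume ?L
  then obtain H where H: "subgroup H G" "finite (lcosets H)"
    and zH: "z \<in> group_center (G\<lparr>carrier := H\<rparr>)" by blast
  have "z \<in> carrier G" "H \<subseteq> centralizer z"
    using zH subgroup.subset[OF H(1)] by (auto simp: group_center_def centralizer_def)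
  then show ?R
    using conjugacy_class_finite[OF H] by blast
next
  assume R: ?R
  then have "z \<in> group_center (G\<lparr>carrier := centralizer z\<rparr>)"
    by (auto simp: group_center_def centralizer_def)
  then show ?L
    using R subgroup_centralizer centralizer_index_finite by blast
qed

end

section \<open>Displacement\<close>

context isometric_action
begin

sublocale group G
  using group_hom by (rule group_hom.axioms(1))

text \<open>
  The isometry \<open>h\<close> maps the pair \<open>g h\<inverse> x\<close>, \<open>h\<inverse> x\<close> to the pair \<open>h g h\<inverse> x\<close>, \<open>x\<close>.
\<close>

lemma displacement_conjugate:
  assumes h: "h \<in> carrier G" and g: "g \<in> carrier G" and x: "x \<in> M"
  shows "d (\<phi> (h \<otimes> g \<otimes> inv h) x) x = d (\<phi> g (\<phi> (inv h) x)) (\<phi> (inv h) x)"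
proof -
  define y where "y = \<phi> (inv h) x"
  have y: "y \<in> M"
    using element_image[OF inv_closed[OF h] x] by (simp add: y_def)
  have gy: "\<phi> g y \<in> M"
    using element_image[OF g y] by simp
  have "\<phi> h y = x"
    using orbit_sym_aux[of "inv h" x y] h x by (simp add: y_def)
  moreover have "\<phi> (h \<otimes> g \<otimes> inv h) x = \<phi> h (\<phi> g y)"
    using h g x y by (simp add: composition_rule y_def)
  ultimately show ?thesis
    using isometric[OF h gy y] by (simp add: y_def)
qed

text \<open>
  A bound on the displacement of \<open>g\<close> at every point bounds the displacement of every conjugate
  at the single point \<open>x\<close>, where proper discontinuity applies.
\<close>

lemma conjugacy_class_finite_if_coarse_kernel:
  assumes pd: "properly_discontinuous_action G M d \<phi>" and x: "x \<in> M"
    and g: "g \<in> coarse_kernel G M d \<phi>"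
  shows "finite (conjugacy_class g)"
proof -
  obtain C where C: "C > 0" "\<And>y. y \<in> M \<Longrightarrow> d (\<phi> g y) y \<le> C" and gG: "g \<in> carrier G"
    using g by (auto simp: coarse_kernel_def)
  have "d (\<phi> (h \<otimes> g \<otimes> inv h) x) x \<le> C" if h: "h \<in> carrier G" for h
    using displacement_conjugate[OF h gG x] C(2) element_image[OF inv_closed[OF h] x] by simp
  then have "conjugacy_class g \<subseteq> {k \<in> carrier G. d (\<phi> k x) x \<le> C}"
    using gG by (auto simp: conjugacy_class_def)
  then show ?thesis
    using pd x C(1) finite_subset by (fastforce simp: properly_discontinuous_action_def)
qed

text \<open>
  The displacement of \<open>g\<close> at \<open>h x0\<close> is that of the conjugate \<open>h\<inverse> g h\<close> at \<open>x0\<close>, so it takes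
  only finitely many values along the orbit of \<open>x0\<close>. The displacement function is Lipschitz
  with constant \<open>2\<close>, which carries the bound from the quasi-dense orbit to all of \<open>M\<close>.
\<close>

lemma coarse_kernel_if_conjugacy_class_finite:
  assumes cb: "cobounded_action G M d \<phi>" and g: "g \<in> carrier G"
    and fin: "finite (conjugacy_class g)"
  shows "g \<in> coarse_kernel G M d \<phi>"
proof -
  obtain x0 L where x0: "x0 \<in> M" and L: "L > 0"
    and dense: "\<And>x. x \<in> M \<Longrightarrow> \<exists>y\<in>orbit G \<phi> x0. d x y \<le> L"
    using cb by (auto simp: cobounded_action_def)
  \<comment> \<open>The sum serves as an upper bound for its nonnegative terms.\<close>
  define B where "B = (\<Sum>k\<in>conjugacy_class g. d (\<phi> k x0) x0)"
  have B: "B \<ge> 0"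
    unfolding B_def by (simp add: sum_nonneg)
  have orbit_bound: "d (\<phi> g y) y \<le> B" if y_orbit: "y \<in> orbit G \<phi> x0" for y
  proof -
    obtain h where h: "h \<in> carrier G" and y: "y = \<phi> h x0"
      using y_orbit by (auto simp: orbit_def)
    have "inv h \<otimes> g \<otimes> inv (inv h) \<in> conjugacy_class g"
      unfolding conjugacy_class_def using h by (intro image_eqI[OF refl]) simp
    then have "d (\<phi> (inv h \<otimes> g \<otimes> inv (inv h)) x0) x0 \<le> B"
      unfolding B_def using fin by (intro member_le_sum) auto
    then show ?thesis
      using displacement_conjugate[of "inv h" g x0] h g x0 y by simp
  qed
  have "d (\<phi> g x) x \<le> 2 * L + B" if x: "x \<in> M" for x
  proof -
    obtain y where y: "y \<in> orbit G \<phi> x0" and xy: "d x y \<le> L"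
      using dense[OF x] by blast
    have yM: "y \<in> M"
      using y element_image[OF _ x0] by (auto simp: orbit_def)
    have gM: "\<phi> g x \<in> M" "\<phi> g y \<in> M"
      using element_image[OF g] x yM by auto
    have "d (\<phi> g x) x \<le> d (\<phi> g x) (\<phi> g y) + d (\<phi> g y) x"
      using triangle[of "\<phi> g x" "\<phi> g y" x] gM x by simp
    also have "d (\<phi> g y) x \<le> d (\<phi> g y) y + d y x"
      using triangle[of "\<phi> g y" y x] gM yM x by simp
    finally show ?thesis
      using isometric[OF g x yM] xy commute[of x y] orbit_bound[OF y] by simp
  qed
  then show ?thesis
    using g L B by (auto simp: coarse_kernel_def intro!: exI[of _ "2 * L + B"])
qed

end

section \<open>The coarse kernel\<close>

theorem theorem1p2:
  fixes G :: "('g, 'r) monoid_scheme"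
    and M :: "'a set" and d :: "'a \<Rightarrow> 'a \<Rightarrow> real" and \<phi> :: "'g \<Rightarrow> 'a \<Rightarrow> 'a"
  assumes "isometric_action G M d \<phi>"
    and "properly_discontinuous_action G M d \<phi>"
    and "cobounded_action G M d \<phi>"
  shows "coarse_kernel G M d \<phi> =
    (\<Union>H\<in>{H. subgroup H G \<and> finite (lcosets\<^bsub>G\<^esub> H)}. group_center (G\<lparr>carrier := H\<rparr>))"
proof -
  interpret isometric_action G M d \<phi>
    by (rule assms(1))
  obtain x where x: "x \<in> M"
    using assms(3) by (auto simp: cobounded_action_def)
  have "g \<in> coarse_kernel G M d \<phi> \<longleftrightarrow> g \<in> carrier G \<and> finite (conjugacy_class g)" for g
    using conjugacy_class_finite_if_coarse_kernel[OF assms(2) x]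
      coarse_kernel_if_conjugacy_class_finite[OF assms(3)]
    by (auto simp: coarse_kernel_def)
  then show ?thesis
    using central_in_finite_index_iff by auto
qed

end
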